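(* The theory INT is equivalent to the theory FUN of normalized positive additive functionals on $R$: the interpretation sending $P(f)$ to $(0<I(f))$, together with the interpretation sending $(p<I(f))$ to $P(f-p)$ and $(I(f)<q)$ to $P(q-f)$, are mutually inverse interpretations between the two propositional geometric theories. In particular the points of INT correspond exactly to integrals on $R$.
   Context: $R$ is a Riesz space over $\mathbb{Q}$ with strong unit $1$ (for every $x$ there is $n$ with $-n1\le x\le n1$); rationals $r$ are identified with $r\cdot1$. INT is the propositional geometric theory with generators $P(f)$, $f\in R$, and relations: $P(1)=1$; $P(f)\wedge P(-f)=0$; $P(f+g)\le P(f)\vee P(g)$; $P(f)=0$ if $f\le0$; $P(f)=\bigvee_{s>0,\,s\in\mathbb{Q}}P(f-s)$. FUN is the propositional geometric theory with generators $(p<I(f))$ and $(I(f)<q)$ for $f\in R$, $p,q\in\mathbb{Q}$, with relations expressing that each $I(f)$ is a Dedekind real (namely: $(p<I(f))\le(p'<I(f))$ for $p'<p$; $(I(f)<q)\le(I(f)<q')$ for $q<q'$; $(p<I(f))=\bigvee_{p'>p}(p'<I(f))$; $(I(f)<q)=\bigvee_{q'<q}(I(f)<q')$; $1=(p<I(f))\vee(I(f)<q)$ for $p<q$; $0=(q<I(f))\wedge(I(f)<p)$ for $p<q$), and that $I(0)=0$, $I(f+g)=I(f)+I(g)$, $I(f)\ge0$ whenever $f\ge0$, and $I(1)=1$. An integral on $R$ is a positive linear functional $I:R\to\mathbb{R}$ with $I(1)=1$. *)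

theory Defs
  imports Complex_Main
begin

definition frame :: "'l::complete_lattice itself \<Rightarrow> bool" where
  "frame _ \<longleftrightarrow> (\<forall>(x::'l) A. inf x (Sup A) = Sup ((\<lambda>a. inf x a) ` A))"

text \<open>smult is the scalar multiplication by rationals, u the strong unit 1.\<close>
definition riesz_space_Q :: "(rat \<Rightarrow> 'r::{ordered_ab_group_add,lattice} \<Rightarrow> 'r) \<Rightarrow> bool" where
  "riesz_space_Q smult \<longleftrightarrow>
     (\<forall>r f g. smult r (f + g) = smult r f + smult r g) \<and>
     (\<forall>r s f. smult (r + s) f = smult r f + smult s f) \<and>
     (\<forall>r s f. smult r (smult s f) = smult (r * s) f) \<and>
     (\<forall>f. smult 1 f = f) \<and>
     (\<forall>r f. 0 \<le> r \<longrightarrow> 0 \<le> f \<longrightarrow> 0 \<le> smult r f)"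

definition strong_unit :: "(rat \<Rightarrow> 'r::{ordered_ab_group_add,lattice} \<Rightarrow> 'r) \<Rightarrow> 'r \<Rightarrow> bool" where
  "strong_unit smult u \<longleftrightarrow>
     (\<forall>x. \<exists>n::nat. smult (- of_nat n) u \<le> x \<and> x \<le> smult (of_nat n) u)"

definition INT_model ::
  "(rat \<Rightarrow> 'r::{ordered_ab_group_add,lattice} \<Rightarrow> 'r) \<Rightarrow> 'r \<Rightarrow> ('r \<Rightarrow> 'l::complete_lattice) \<Rightarrow> bool" where
  "INT_model smult u P \<longleftrightarrow>
     P u = top \<and>
     (\<forall>f. inf (P f) (P (- f)) = bot) \<and>
     (\<forall>f g. P (f + g) \<le> sup (P f) (P g)) \<and>
     (\<forall>f. f \<le> 0 \<longrightarrow> P f = bot) \<and>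
     (\<forall>f. P f = Sup {P (f - smult s u) | s. s > 0})"

text \<open>lt p f stands for (p < I(f)), gt f q for (I(f) < q).\<close>

definition dedekind_real :: "(rat \<Rightarrow> 'l::complete_lattice) \<Rightarrow> (rat \<Rightarrow> 'l) \<Rightarrow> bool" where
  "dedekind_real L U \<longleftrightarrow>
     (\<forall>p p'. p' < p \<longrightarrow> L p \<le> L p') \<and>
     (\<forall>q q'. q < q' \<longrightarrow> U q \<le> U q') \<and>
     (\<forall>p. L p = Sup {L p' | p'. p' > p}) \<and>
     (\<forall>q. U q = Sup {U q' | q'. q' < q}) \<and>
     (\<forall>p q. p < q \<longrightarrow> sup (L p) (U q) = top) \<and>
     (\<forall>p q. p < q \<longrightarrow> inf (L q) (U p) = bot)"

definition real_eq_const :: "(rat \<Rightarrow> 'l::complete_lattice) \<Rightarrow> (rat \<Rightarrow> 'l) \<Rightarrow> rat \<Rightarrow> bool" where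
  "real_eq_const L U c \<longleftrightarrow>
     (\<forall>p. L p = (if p < c then top else bot)) \<and> (\<forall>q. U q = (if c < q then top else bot))"

definition real_add_rel ::
  "(rat \<Rightarrow> 'l::complete_lattice) \<Rightarrow> (rat \<Rightarrow> 'l) \<Rightarrow> (rat \<Rightarrow> 'l) \<Rightarrow> (rat \<Rightarrow> 'l)
   \<Rightarrow> (rat \<Rightarrow> 'l) \<Rightarrow> (rat \<Rightarrow> 'l) \<Rightarrow> bool" where
  "real_add_rel Lz Uz Lx Ux Ly Uy \<longleftrightarrow>
     (\<forall>p. Lz p = Sup {inf (Lx p1) (Ly p2) | p1 p2. p1 + p2 = p}) \<and>
     (\<forall>q. Uz q = Sup {inf (Ux q1) (Uy q2) | q1 q2. q1 + q2 = q})"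

definition FUN_model ::
  "(rat \<Rightarrow> 'r::{ordered_ab_group_add,lattice} \<Rightarrow> 'r) \<Rightarrow> 'r
   \<Rightarrow> (rat \<Rightarrow> 'r \<Rightarrow> 'l::complete_lattice) \<Rightarrow> ('r \<Rightarrow> rat \<Rightarrow> 'l) \<Rightarrow> bool" where
  "FUN_model smult u lt gt \<longleftrightarrow>
     (\<forall>f. dedekind_real (\<lambda>p. lt p f) (gt f)) \<and>
     real_eq_const (\<lambda>p. lt p 0) (gt 0) 0 \<and>
     (\<forall>f g. real_add_rel (\<lambda>p. lt p (f + g)) (gt (f + g))
                          (\<lambda>p. lt p f) (gt f) (\<lambda>p. lt p g) (gt g)) \<and>
     (\<forall>f q. 0 \<le> f \<longrightarrow> q \<le> 0 \<longrightarrow> gt f q = bot) \<and>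
     real_eq_const (\<lambda>p. lt p u) (gt u) 1"

definition integral_on :: "(rat \<Rightarrow> 'r::{ordered_ab_group_add,lattice} \<Rightarrow> 'r) \<Rightarrow> 'r \<Rightarrow> ('r \<Rightarrow> real) \<Rightarrow> bool" where
  "integral_on smult u I \<longleftrightarrow>
     (\<forall>f g. I (f + g) = I f + I g) \<and>
     (\<forall>r f. I (smult r f) = of_rat r * I f) \<and>
     (\<forall>f. 0 \<le> f \<longrightarrow> 0 \<le> I f) \<and>
     I u = 1"

end

theory Submission
  imports Defs
begin

(* Write r for the element smult r u.  Going from INT to FUN, a model P of INT yields
   the cuts  (p < I f) := P (f - p)  and  (I f < q) := P (q - f).  The decisive facts are
   that these cuts are located (via the Archimedean property of u and distributivity of
   the frame) and that  P (f + g - p)  is the join of  P (f - p1) /\ P (g - p2)  over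
   p1 + p2 = p, so that I is additive.  Going from FUN to INT, a model (lt, gt) of FUN
   satisfies I (r) = r for every rational r (first for naturals, then integers, then
   fractions), and Dedekind addition with a constant is a shift; this yields
   lt p f = lt 0 (f - p) and gt f q = lt 0 (q - f), from which the INT axioms for
   lt 0 follow.  Finally, in the two-element frame bool an INT model P is a single cut
   datum, and  I f = sup {p. P (f - p)}  is an integral with  0 < I f <-> P f;
   conversely every integral I gives the model  0 < I f, and I is recovered from it. *)

section \<open>Rational vector lattices with a strong unit\<close>

locale rat_module =
  fixes smult :: "rat \<Rightarrow> 'r::{ordered_ab_group_add,lattice} \<Rightarrow> 'r"
  assumes riesz: "riesz_space_Q smult"
begin

lemma sm_addL: "smult (r + s) f = smult r f + smult s f"
  using riesz unfolding riesz_space_Q_def by blast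
lemma sm_assoc: "smult r (smult s f) = smult (r * s) f"
  using riesz unfolding riesz_space_Q_def by blast
lemma sm_one: "smult 1 f = f"
  using riesz unfolding riesz_space_Q_def by blast
lemma sm_pos: "0 \<le> r \<Longrightarrow> 0 \<le> f \<Longrightarrow> 0 \<le> smult r f"
  using riesz unfolding riesz_space_Q_def by blast

lemma sm_zeroL [simp]: "smult 0 f = 0"
  using sm_addL[of 0 0 f] by simp

lemma sm_negL: "smult (- r) f = - smult r f"
  using minus_unique[of "smult r f" "smult (- r) f"] sm_addL[of r "- r" f] by simp

lemma sm_diffL: "smult (r - s) f = smult r f - smult s f"
  using sm_addL[of r "- s" f] sm_negL[of s f] by simp

lemma sm_Suc: "smult (of_nat (Suc n)) f = smult (of_nat n) f + f"
  unfolding of_nat_Suc sm_addL sm_one by (rule add.commute)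

text \<open>An additive real-valued map on a rational vector space is automatically
  rational-homogeneous; this makes the real number defined by a point of INT an integral.\<close>
lemma additive_rat_homogeneous:
  assumes add: "\<And>f g. I (f + g) = (I f + I g :: real)"
  shows "I (smult r f) = of_rat r * I f"
proof -
  have I0: "I 0 = 0" using add[of 0 0] by simp
  have Ineg: "I (- x) = - I x" for x using add[of x "- x"] I0 by simp
  have Inat: "I (smult (of_nat n) x) = of_nat n * I x" for n x
  proof (induction n)
    case (Suc n)
    show ?case unfolding sm_Suc add Suc by (simp add: algebra_simps)
  qed (simp add: I0)
  have Iint: "I (smult (of_int m) x) = of_int m * I x" for m x
  proof (cases "m \<ge> 0")
    case True
    then show ?thesis using Inat[of "nat m" x] by simp
  next
    case False
    then have "(of_int m :: rat) = - of_nat (nat (- m))" by simp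
    then show ?thesis using Inat[of "nat (- m)" x] False by (simp add: sm_negL Ineg)
  qed
  obtain m n where q: "quotient_of r = (m, n)" by (cases "quotient_of r") auto
  have n: "n > 0" using quotient_of_denom_pos[OF q] .
  have r: "r = of_int m / of_int n" using quotient_of_div[OF q] .
  have nr: "of_int n * r = of_int m" using n by (simp add: r)
  have "of_int n * I (smult r f) = I (smult (of_int n) (smult r f))" by (simp add: Iint)
  also have "\<dots> = I (smult (of_int m) f)" by (simp add: sm_assoc nr)
  also have "\<dots> = of_int n * (of_rat r * I f)"
    using n by (simp add: Iint r of_rat_divide)
  finally show ?thesis using n by simp
qed

end

locale riesz_unit = rat_module smult
  for smult :: "rat \<Rightarrow> 'r::{ordered_ab_group_add,lattice} \<Rightarrow> 'r" +
  fixes u :: 'r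
  assumes unit: "strong_unit smult u"
begin

text \<open>The strong unit is positive: from  -n u \<le> u \<le> n u  we get  0 \<le> 2n u.\<close>
lemma u_nonneg: "0 \<le> u"
proof -
  obtain n :: nat where n: "smult (- of_nat n) u \<le> u" "u \<le> smult (of_nat n) u"
    using unit unfolding strong_unit_def by blast
  show ?thesis
  proof (cases "n = 0")
    case True
    then show ?thesis using n by simp
  next
    case False
    have "0 \<le> smult (of_nat n) u - smult (- of_nat n) u" using n by simp
    also have "\<dots> = smult (2 * of_nat n) u" using sm_diffL[of "of_nat n" "- of_nat n" u] by simp
    finally have h: "0 \<le> smult (2 * of_nat n) u" .
    have "0 \<le> smult (1 / (2 * of_nat n)) (smult (2 * of_nat n) u)"
      by (rule sm_pos[OF _ h]) simp
    also have "\<dots> = u" using False by (simp add: sm_assoc sm_one)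
    finally show ?thesis .
  qed
qed

lemma smu_mono: "r \<le> s \<Longrightarrow> smult r u \<le> smult s u"
  using sm_pos[of "s - r" u] u_nonneg sm_diffL[of s r u] by simp

lemma smu_nonpos: "r \<le> 0 \<Longrightarrow> smult r u \<le> 0"
  using smu_mono[of r 0] by simp

lemma bounded: "\<exists>N::rat. N > 0 \<and> smult (- N) u \<le> f \<and> f \<le> smult N u"
proof -
  obtain n :: nat where n: "smult (- of_nat n) u \<le> f" "f \<le> smult (of_nat n) u"
    using unit unfolding strong_unit_def by blast
  have "smult (- (of_nat n + 1)) u \<le> smult (- of_nat n) u"
       "smult (of_nat n) u \<le> smult (of_nat n + 1) u"
    by (simp_all add: smu_mono)
  with n show ?thesis
    by (intro exI[of _ "of_nat n + 1"]) (auto intro: order_trans simp del: minus_add_distrib)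
qed

end

lemma frame_inf_Sup:
  "frame TYPE('l::complete_lattice) \<Longrightarrow> inf (x::'l) (Sup A) = Sup ((\<lambda>a. inf x a) ` A)"
  unfolding frame_def by blast

lemma frame_inf_sup:
  "frame TYPE('l::complete_lattice) \<Longrightarrow> inf (x::'l) (sup a b) = sup (inf x a) (inf x b)"
  using frame_inf_Sup[of x "{a, b}"] by simp

text \<open>The two-element frame; its models are the points of a theory.\<close>
lemma frame_bool: "frame TYPE(bool)"
  unfolding frame_def by auto

lemma Sup_shift_up:
  fixes F :: "rat \<Rightarrow> 'a::complete_lattice"
  shows "Sup {F (p + s) | s. s > 0} = Sup {F p' | p'. p' > p}"
proof (rule arg_cong[where f = Sup], intro set_eqI iffI)
  fix x assume "x \<in> {F (p + s) | s. s > 0}"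
  then show "x \<in> {F p' | p'. p' > p}" by auto
next
  fix x assume "x \<in> {F p' | p'. p' > p}"
  then obtain p' where "x = F p'" "p' > p" by blast
  then show "x \<in> {F (p + s) | s. s > 0}" by (intro CollectI exI[of _ "p' - p"]) simp
qed

lemma Sup_shift_down:
  fixes F :: "rat \<Rightarrow> 'a::complete_lattice"
  shows "Sup {F (q - s) | s. s > 0} = Sup {F q' | q'. q' < q}"
proof (rule arg_cong[where f = Sup], intro set_eqI iffI)
  fix x assume "x \<in> {F (q - s) | s. s > 0}"
  then show "x \<in> {F q' | q'. q' < q}" by auto
next
  fix x assume "x \<in> {F q' | q'. q' < q}"
  then obtain q' where "x = F q'" "q' < q" by blast
  then show "x \<in> {F (q - s) | s. s > 0}" by (intro CollectI exI[of _ "q - q'"]) simp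
qed

lemma sum_set_swap:
  fixes F :: "rat \<Rightarrow> rat \<Rightarrow> 'a"
  shows "{F p1 p2 | p1 p2. p1 + p2 = p} = {F p2 p1 | p1 p2. p1 + p2 = p}"
proof (intro set_eqI iffI)
  fix x assume "x \<in> {F p1 p2 | p1 p2. p1 + p2 = p}"
  then obtain p1 p2 where "x = F p1 p2" "p1 + p2 = p" by blast
  then show "x \<in> {F p2 p1 | p1 p2. p1 + p2 = p}" by (intro CollectI exI[of _ p2] exI[of _ p1]) simp
next
  fix x assume "x \<in> {F p2 p1 | p1 p2. p1 + p2 = p}"
  then obtain p1 p2 where "x = F p2 p1" "p1 + p2 = p" by blast
  then show "x \<in> {F p1 p2 | p1 p2. p1 + p2 = p}" by (intro CollectI exI[of _ p2] exI[of _ p1]) simp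
qed

lemma sum_set_neg:
  fixes F :: "rat \<Rightarrow> rat \<Rightarrow> 'a"
  shows "{F p1 p2 | p1 p2. p1 + p2 = - q} = {F (- q1) (- q2) | q1 q2. q1 + q2 = q}"
proof (intro set_eqI iffI)
  fix x assume "x \<in> {F p1 p2 | p1 p2. p1 + p2 = - q}"
  then obtain p1 p2 where "x = F p1 p2" "p1 + p2 = - q" by blast
  then show "x \<in> {F (- q1) (- q2) | q1 q2. q1 + q2 = q}"
    by (intro CollectI exI[of _ "- p1"] exI[of _ "- p2"]) simp
next
  fix x assume "x \<in> {F (- q1) (- q2) | q1 q2. q1 + q2 = q}"
  then obtain q1 q2 where "x = F (- q1) (- q2)" "q1 + q2 = q" by blast
  then show "x \<in> {F p1 p2 | p1 p2. p1 + p2 = - q}"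
    by (intro CollectI exI[of _ "- q1"] exI[of _ "- q2"]) simp
qed

section \<open>Dedekind reals in a frame\<close>

text \<open>A Dedekind real  (L, U)  consists of a lower cut  L p = (p < x)  and an upper cut
  U q = (x < q)  with values in a complete lattice.\<close>

lemma dr_monoL: assumes "dedekind_real L U" "p' \<le> p" shows "L p \<le> L p'"
proof (cases "p' = p")
  case False
  then show ?thesis using assms unfolding dedekind_real_def by (metis order_less_le)
qed simp

lemma dr_roundL: "dedekind_real L U \<Longrightarrow> L p = Sup {L p' | p'. p' > p}"
  unfolding dedekind_real_def by blast

lemma dr_roundU: "dedekind_real L U \<Longrightarrow> U q = Sup {U q' | q'. q' < q}"
  unfolding dedekind_real_def by blast

lemma dr_located: "dedekind_real L U \<Longrightarrow> p < q \<Longrightarrow> sup (L p) (U q) = top"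
  unfolding dedekind_real_def by blast

lemma dr_disjoint: "dedekind_real L U \<Longrightarrow> p < q \<Longrightarrow> inf (L q) (U p) = bot"
  unfolding dedekind_real_def by blast

lemma add_lowerL:
  assumes "real_add_rel Lz Uz Lx Ux Ly Uy" shows "inf (Lx p1) (Ly p2) \<le> Lz (p1 + p2)"
proof -
  have "Lz (p1 + p2) = Sup {inf (Lx a) (Ly b) | a b. a + b = p1 + p2}"
    using assms unfolding real_add_rel_def by blast
  moreover have "inf (Lx p1) (Ly p2) \<in> {inf (Lx a) (Ly b) | a b. a + b = p1 + p2}" by blast
  ultimately show ?thesis by (simp add: Sup_upper)
qed

lemma add_lowerU:
  assumes "real_add_rel Lz Uz Lx Ux Ly Uy" shows "inf (Ux q1) (Uy q2) \<le> Uz (q1 + q2)"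
proof -
  have "Uz (q1 + q2) = Sup {inf (Ux a) (Uy b) | a b. a + b = q1 + q2}"
    using assms unfolding real_add_rel_def by blast
  moreover have "inf (Ux q1) (Uy q2) \<in> {inf (Ux a) (Uy b) | a b. a + b = q1 + q2}" by blast
  ultimately show ?thesis by (simp add: Sup_upper)
qed

lemma add_sym: "real_add_rel Lz Uz Lx Ux Ly Uy \<Longrightarrow> real_add_rel Lz Uz Ly Uy Lx Ux"
  unfolding real_add_rel_def
  by (simp add: sum_set_swap[of "\<lambda>a b. inf (Lx a) (Ly b)"]
      sum_set_swap[of "\<lambda>a b. inf (Ux a) (Uy b)"] inf_commute)

text \<open>If  x + y = c, then  y = c - x, i.e. the lower cut of y is the upper cut of x
  reflected at c.  Locatedness of x and y, together with distributivity, gives this.\<close>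
lemma add_neg:
  assumes FR: "frame TYPE('l::complete_lattice)"
    and dx: "dedekind_real Lx Ux" and dy: "dedekind_real Ly (Uy :: rat \<Rightarrow> 'l)"
    and ad: "real_add_rel Lz Uz Lx Ux Ly Uy" and cz: "real_eq_const Lz Uz c"
  shows "Ly p = Ux (c - p)"
proof (rule antisym)
  have Lc: "Lz c = bot" "Uz c = bot" using cz unfolding real_eq_const_def by auto
  have "Ly p = Sup {Ly p' | p'. p' > p}" by (rule dr_roundL[OF dy])
  also have "\<dots> \<le> Ux (c - p)"
  proof (rule Sup_least)
    fix y assume "y \<in> {Ly p' | p'. p' > p}"
    then obtain p' where y: "y = Ly p'" and pp: "p' > p" by blast
    have "y = inf (Ly p') (sup (Lx (c - p')) (Ux (c - p)))"
      using dr_located[OF dx, of "c - p'" "c - p"] pp y by simp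
    also have "\<dots> = sup (inf (Ly p') (Lx (c - p'))) (inf (Ly p') (Ux (c - p)))"
      by (rule frame_inf_sup[OF FR])
    also have "inf (Ly p') (Lx (c - p')) = bot"
      using add_lowerL[OF ad, of "c - p'" p'] Lc by (simp add: inf_commute bot_unique)
    finally show "y \<le> Ux (c - p)" by simp
  qed
  finally show "Ly p \<le> Ux (c - p)" .
next
  have Lc: "Lz c = bot" "Uz c = bot" using cz unfolding real_eq_const_def by auto
  have "Ux (c - p) = Sup {Ux q | q. q < c - p}" by (rule dr_roundU[OF dx])
  also have "\<dots> \<le> Ly p"
  proof (rule Sup_least)
    fix y assume "y \<in> {Ux q | q. q < c - p}"
    then obtain q where y: "y = Ux q" and qq: "q < c - p" by blast
    have "y = inf (Ux q) (sup (Ly p) (Uy (c - q)))"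
      using dr_located[OF dy, of p "c - q"] qq y by simp
    also have "\<dots> = sup (inf (Ux q) (Ly p)) (inf (Ux q) (Uy (c - q)))"
      by (rule frame_inf_sup[OF FR])
    also have "inf (Ux q) (Uy (c - q)) = bot"
      using add_lowerU[OF ad, of q "c - q"] Lc by (simp add: bot_unique)
    finally show "y \<le> Ly p" by simp
  qed
  finally show "Ux (c - p) \<le> Ly p" .
qed

lemma add_const:
  assumes ad: "real_add_rel Lz Uz Lx Ux Ly Uy"
    and cx: "real_eq_const Lx Ux a" and cy: "real_eq_const Ly Uy b"
  shows "real_eq_const Lz Uz (a + b)"
proof -
  have LxE: "Lx p = (if p < a then top else bot)" "Ux p = (if a < p then top else bot)" for p
    using cx unfolding real_eq_const_def by auto
  have LyE: "Ly p = (if p < b then top else bot)" "Uy p = (if b < p then top else bot)" for p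
    using cy unfolding real_eq_const_def by auto
  have L: "Lz p = (if p < a + b then top else bot)" for p
  proof (cases "p < a + b")
    case True
    define e where "e = (a + b - p) / 2"
    have "top = inf (Lx (a - e)) (Ly (b - e))" using True by (simp add: LxE LyE e_def)
    also have "\<dots> \<le> Lz (a - e + (b - e))" by (rule add_lowerL[OF ad])
    also have "a - e + (b - e) = p" by (simp add: e_def field_simps)
    finally show ?thesis using True by (simp add: top_le)
  next
    case False
    have "Lz p = Sup {inf (Lx p1) (Ly p2) | p1 p2. p1 + p2 = p}"
      using ad unfolding real_add_rel_def by blast
    also have "\<dots> = bot" using False by (auto simp: LxE LyE)
    finally show ?thesis using False by simp
  qed
  have U: "Uz q = (if a + b < q then top else bot)" for q
  proof (cases "a + b < q")
    case True
    define e where "e = (q - a - b) / 2"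
    have "top = inf (Ux (a + e)) (Uy (b + e))" using True by (simp add: LxE LyE e_def)
    also have "\<dots> \<le> Uz (a + e + (b + e))" by (rule add_lowerU[OF ad])
    also have "a + e + (b + e) = q" by (simp add: e_def field_simps)
    finally show ?thesis using True by (simp add: top_le)
  next
    case False
    have "Uz q = Sup {inf (Ux q1) (Uy q2) | q1 q2. q1 + q2 = q}"
      using ad unfolding real_add_rel_def by blast
    also have "\<dots> = bot" using False by (auto simp: LxE LyE)
    finally show ?thesis using False by simp
  qed
  show ?thesis unfolding real_eq_const_def using L U by blast
qed

text \<open>A Dedekind real whose lower cut vanishes at all  p \<ge> c  and whose upper cut
  vanishes at all  q \<le> c  equals c: locatedness supplies the remaining values.\<close>
lemma const_from_bounds:
  assumes d: "dedekind_real L U"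
    and bl: "\<And>p. \<not> p < c \<Longrightarrow> L p = bot" and bu: "\<And>q. \<not> c < q \<Longrightarrow> U q = bot"
  shows "real_eq_const L U c"
proof -
  have "L p = top" if "p < c" for p
    using dr_located[OF d, of p "(p + c) / 2"] bu[of "(p + c) / 2"] that by simp
  moreover have "U q = top" if "c < q" for q
    using dr_located[OF d, of "(q + c) / 2" q] bl[of "(q + c) / 2"] that by simp
  ultimately show ?thesis unfolding real_eq_const_def using bl bu by auto
qed

lemma shift_const:
  assumes dx: "dedekind_real Lx Ux" and ad: "real_add_rel Lz Uz Lx Ux Ly Uy"
    and cy: "real_eq_const Ly Uy b"
  shows "Lz p = Lx (p - b)"
proof (rule antisym)
  have LyE: "Ly p = (if p < b then top else bot)" for p
    using cy unfolding real_eq_const_def by auto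
  have "Lz p = Sup {inf (Lx p1) (Ly p2) | p1 p2. p1 + p2 = p}"
    using ad unfolding real_add_rel_def by blast
  also have "\<dots> \<le> Lx (p - b)"
  proof (rule Sup_least)
    fix x assume "x \<in> {inf (Lx p1) (Ly p2) | p1 p2. p1 + p2 = p}"
    then obtain p1 p2 where x: "x = inf (Lx p1) (Ly p2)" and pp: "p1 + p2 = p" by blast
    show "x \<le> Lx (p - b)"
    proof (cases "p2 < b")
      case True
      then have "Lx p1 \<le> Lx (p - b)" using pp by (intro dr_monoL[OF dx]) simp
      then show ?thesis using x by (simp add: le_infI1)
    qed (simp add: x LyE)
  qed
  finally show "Lz p \<le> Lx (p - b)" .
next
  have LyE: "Ly p = (if p < b then top else bot)" for p
    using cy unfolding real_eq_const_def by auto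
  have "Lx (p - b) = Sup {Lx p' | p'. p' > p - b}" by (rule dr_roundL[OF dx])
  also have "\<dots> \<le> Lz p"
  proof (rule Sup_least)
    fix y assume "y \<in> {Lx p' | p'. p' > p - b}"
    then obtain p' where y: "y = Lx p'" and pp: "p' > p - b" by blast
    have "y = inf (Lx p') (Ly (p - p'))" using y pp by (simp add: LyE)
    also have "\<dots> \<le> Lz (p' + (p - p'))" by (rule add_lowerL[OF ad])
    finally show "y \<le> Lz p" by simp
  qed
  finally show "Lx (p - b) \<le> Lz p" .
qed

section \<open>From INT to FUN\<close>

text \<open>A model P of INT in a frame; P f reads "f > 0".\<close>
locale INT_frame_model = riesz_unit smult u
  for smult :: "rat \<Rightarrow> 'r::{ordered_ab_group_add,lattice} \<Rightarrow> 'r" and u +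
  fixes P :: "'r \<Rightarrow> 'l::complete_lattice"
  assumes frame: "frame TYPE('l)" and model: "INT_model smult u P"
begin

lemma P_u: "P u = top"
  using model unfolding INT_model_def by blast
lemma P_disj: "inf (P f) (P (- f)) = bot"
  using model unfolding INT_model_def by blast
lemma P_sub: "P (f + g) \<le> sup (P f) (P g)"
  using model unfolding INT_model_def by blast
lemma P_nonpos: "f \<le> 0 \<Longrightarrow> P f = bot"
  using model unfolding INT_model_def by blast
lemma P_round: "P f = Sup {P (f - smult s u) | s. s > 0}"
  using model unfolding INT_model_def by blast

lemma P_mono: assumes "a \<le> b" shows "P a \<le> P b"
proof -
  have "P a = P (b + (a - b))" by simp
  also have "\<dots> \<le> sup (P b) (P (a - b))" by (rule P_sub)
  also have "P (a - b) = bot" using assms by (intro P_nonpos) simp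
  finally show ?thesis by simp
qed

lemma P_meet: "inf (P a) (P b) \<le> P (a + b)"
proof -
  have "P b = P ((a + b) + (- a))" by (simp add: algebra_simps)
  also have "\<dots> \<le> sup (P (a + b)) (P (- a))" by (rule P_sub)
  finally have "inf (P a) (P b) \<le> inf (P a) (sup (P (a + b)) (P (- a)))" by (intro inf_mono order_refl)
  also have "\<dots> = sup (inf (P a) (P (a + b))) (inf (P a) (P (- a)))" by (rule frame_inf_sup[OF frame])
  also have "\<dots> \<le> P (a + b)" by (simp add: P_disj le_infI2)
  finally show ?thesis .
qed

text \<open>Positive rational multiples of the unit are positive: by subadditivity
  P ((k + 1) c) \<le> P (c), and some multiple of c exceeds u.\<close>
lemma P_smu_pos: assumes c: "c > 0" shows "P (smult c u) = top"
proof -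
  have multiple: "P (smult (of_nat (Suc k) * c) u) \<le> P (smult c u)" for k
  proof (induction k)
    case (Suc k)
    have "smult (of_nat (Suc (Suc k)) * c) u = smult (of_nat (Suc k) * c) u + smult c u"
      by (simp add: sm_addL[symmetric] algebra_simps)
    then show ?case using P_sub[of "smult (of_nat (Suc k) * c) u" "smult c u"] Suc
      by (simp add: sup_absorb2)
  qed simp
  obtain n :: nat where n: "1 < of_nat n * c" using ex_less_of_nat_mult[OF c] by blast
  then obtain k where k: "n = Suc k" by (cases n) auto
  have "top = P (smult 1 u)" by (simp add: P_u sm_one)
  also have "\<dots> \<le> P (smult (of_nat n * c) u)" using n by (intro P_mono smu_mono) simp
  also have "\<dots> \<le> P (smult c u)" using multiple[of k] k by simp
  finally show ?thesis by (simp add: top_le)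
qed

lemma P_smu: "P (smult c u) = (if 0 < c then top else bot)"
  using P_smu_pos P_nonpos[OF smu_nonpos, of c] by simp

lemma P_located: assumes "x < y" shows "sup (P (f - smult x u)) (P (smult y u - f)) = top"
proof -
  have "top = P (smult (y - x) u)" using assms by (simp add: P_smu)
  also have "smult (y - x) u = (f - smult x u) + (smult y u - f)" by (simp add: sm_diffL algebra_simps)
  also have "P \<dots> \<le> sup (P (f - smult x u)) (P (smult y u - f))" by (rule P_sub)
  finally show ?thesis by (simp add: top_le)
qed

text \<open>One step of the approximation below: moving the lower bound from b down to
  b' < b, either f > b already or f lies in the window  (b', b' + s).\<close>
lemma P_step_down:
  assumes "b' < b" "b < b' + s"
  shows "P (f - smult b' u)
           \<le> sup (P (f - smult b u)) (inf (P (f - smult b' u)) (P (smult (b' + s) u - f)))"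
proof -
  have "P (f - smult b' u)
          = inf (P (f - smult b' u)) (sup (P (f - smult b u)) (P (smult (b' + s) u - f)))"
    using P_located[of b "b' + s" f] assms by simp
  also have "\<dots> = sup (inf (P (f - smult b' u)) (P (f - smult b u)))
                     (inf (P (f - smult b' u)) (P (smult (b' + s) u - f)))"
    by (rule frame_inf_sup[OF frame])
  also have "\<dots> \<le> sup (P (f - smult b u)) (inf (P (f - smult b' u)) (P (smult (b' + s) u - f)))"
    by (intro sup_mono inf_le2 order_refl)
  finally show ?thesis .
qed

text \<open>Every f can be located in some window of width s > 0.  Starting above the bound N
  of f and stepping down by s/2, the Archimedean property reaches a value below -N.\<close>
lemma P_locate:
  assumes s: "s > 0"
  shows "Sup {inf (P (f - smult a u)) (P (smult (a + s) u - f)) | a. True} = top"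
proof -
  define W where "W = Sup {inf (P (f - smult a u)) (P (smult (a + s) u - f)) | a. True}"
  obtain N where N: "N > 0" "smult (- N) u \<le> f" "f \<le> smult N u" using bounded by blast
  define d where "d = s / 2"
  have d: "0 < d" "d < s" using s by (auto simp: d_def)
  have descend: "P (f - smult (N - of_nat k * d) u) \<le> W" for k :: nat
  proof (induction k)
    case 0
    have "P (f - smult N u) = bot" using N by (intro P_nonpos) simp
    then show ?case by simp
  next
    case (Suc k)
    define b where "b = N - of_nat k * d"
    define b' where "b' = N - of_nat (Suc k) * d"
    have "b' < b" "b < b' + s" using d by (simp_all add: b_def b'_def algebra_simps)
    then have "P (f - smult b' u)
                 \<le> sup (P (f - smult b u)) (inf (P (f - smult b' u)) (P (smult (b' + s) u - f)))"
      by (rule P_step_down)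
    also have "\<dots> \<le> W"
    proof (rule sup_least)
      show "P (f - smult b u) \<le> W" using Suc by (simp add: b_def)
      show "inf (P (f - smult b' u)) (P (smult (b' + s) u - f)) \<le> W"
        unfolding W_def by (rule Sup_upper) blast
    qed
    finally show ?case by (simp add: b'_def)
  qed
  obtain k :: nat where k: "2 * N < of_nat k * d" using ex_less_of_nat_mult[OF d(1)] by blast
  define b where "b = N - of_nat k * d"
  have "0 < - N - b" using k by (simp add: b_def)
  then have "top = P (smult (- N - b) u)" by (simp add: P_smu)
  also have "\<dots> \<le> P (f - smult b u)"
    using N(2) by (intro P_mono) (simp add: sm_diffL algebra_simps diff_right_mono)
  also have "\<dots> \<le> W" using descend[of k] by (simp add: b_def)
  finally show ?thesis by (simp add: W_def top_le)
qed

lemma P_round_shift: "P (f - smult p u) = Sup {P (f - smult (p + s) u) | s. s > 0}"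
  using P_round[of "f - smult p u"] by (simp add: sm_addL diff_diff_eq)

lemma P_roundL: "P (f - smult p u) = Sup {P (f - smult p' u) | p'. p' > p}"
  unfolding P_round_shift[of f p] by (fact Sup_shift_up[of "\<lambda>p'. P (f - smult p' u)" p])

lemma P_roundU: "P (smult q u - f) = Sup {P (smult q' u - f) | q'. q' < q}"
proof -
  have shift: "smult q u - f - smult s u = smult (q - s) u - f" for s
    by (simp add: sm_diffL algebra_simps)
  have "P (smult q u - f) = Sup {P (smult q u - f - smult s u) | s. s > 0}" by (rule P_round)
  also have "\<dots> = Sup {P (smult (q - s) u - f) | s. s > 0}" by (simp only: shift)
  also have "\<dots> = Sup {P (smult q' u - f) | q'. q' < q}"
    by (fact Sup_shift_down[of "\<lambda>q'. P (smult q' u - f)" q])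
  finally show ?thesis .
qed

lemma P_add_approx:
  "inf (P (f + g - smult (p + s) u)) (inf (P (f - smult a u)) (P (smult (a + s) u - f)))
     \<le> inf (P (f - smult a u)) (P (g - smult (p - a) u))"
proof -
  define X where "X = P (g - smult (p - a) u)"
  define Y where "Y = P (f - smult (a + s) u)"
  define Z where "Z = P (smult (a + s) u - f)"
  have "f + g - smult (p + s) u = (g - smult (p - a) u) + (f - smult (a + s) u)"
    by (simp add: sm_addL sm_diffL algebra_simps)
  then have sum: "P (f + g - smult (p + s) u) \<le> sup X Y"
    unfolding X_def Y_def by (metis P_sub)
  have "inf Z Y = bot" using P_disj[of "f - smult (a + s) u"] by (simp add: Y_def Z_def inf_commute)
  then have window: "inf Z (sup X Y) \<le> X" by (simp add: frame_inf_sup[OF frame])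
  have "inf (P (f + g - smult (p + s) u)) (inf (P (f - smult a u)) Z)
          \<le> inf (P (f - smult a u)) (inf Z (sup X Y))"
    using sum by (auto intro: le_infI1 le_infI2)
  also have "\<dots> \<le> inf (P (f - smult a u)) X" using window by (rule inf_mono[OF order_refl])
  finally show ?thesis by (simp add: X_def Z_def)
qed

lemma P_add:
  "P (f + g - smult p u) = Sup {inf (P (f - smult p1 u)) (P (g - smult p2 u)) | p1 p2. p1 + p2 = p}"
  (is "_ = Sup ?S")
proof (rule antisym)
  have "P (f + g - smult (p + s) u) \<le> Sup ?S" if "s > 0" for s
  proof -
    let ?W = "{inf (P (f - smult a u)) (P (smult (a + s) u - f)) | a. True}"
    have "P (f + g - smult (p + s) u) = Sup ((\<lambda>w. inf (P (f + g - smult (p + s) u)) w) ` ?W)"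
      using frame_inf_Sup[OF frame, of "P (f + g - smult (p + s) u)" ?W] P_locate[OF that, of f]
      by simp
    also have "\<dots> \<le> Sup ?S"
    proof (rule Sup_least)
      fix z assume "z \<in> (\<lambda>w. inf (P (f + g - smult (p + s) u)) w) ` ?W"
      then obtain a where "z = inf (P (f + g - smult (p + s) u))
                                   (inf (P (f - smult a u)) (P (smult (a + s) u - f)))" by blast
      also have "\<dots> \<le> inf (P (f - smult a u)) (P (g - smult (p - a) u))" by (rule P_add_approx)
      also have "\<dots> \<le> Sup ?S" by (rule Sup_upper) force
      finally show "z \<le> Sup ?S" .
    qed
    finally show ?thesis .
  qed
  then show "P (f + g - smult p u) \<le> Sup ?S"
    by (subst P_round_shift) (blast intro: Sup_least)
next
  show "Sup ?S \<le> P (f + g - smult p u)"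
  proof (rule Sup_least)
    fix x assume "x \<in> ?S"
    then obtain p1 p2 where x: "x = inf (P (f - smult p1 u)) (P (g - smult p2 u))" and "p1 + p2 = p"
      by blast
    then have "smult p u = smult p1 u + smult p2 u" by (simp add: sm_addL[symmetric])
    then have sum: "(f - smult p1 u) + (g - smult p2 u) = f + g - smult p u"
      by (simp add: algebra_simps)
    show "x \<le> P (f + g - smult p u)" unfolding x sum[symmetric] by (rule P_meet)
  qed
qed

lemma P_addU:
  "P (smult q u - (f + g)) = Sup {inf (P (smult q1 u - f)) (P (smult q2 u - g)) | q1 q2. q1 + q2 = q}"
proof -
  have neg: "- h - smult (- r) u = smult r u - h" for h r by (simp add: sm_negL)
  have "P (smult q u - (f + g)) = P ((- f) + (- g) - smult (- q) u)" by (simp add: sm_negL algebra_simps)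
  also have "\<dots> = Sup {inf (P (- f - smult p1 u)) (P (- g - smult p2 u)) | p1 p2. p1 + p2 = - q}"
    by (rule P_add)
  also have "\<dots> = Sup {inf (P (smult q1 u - f)) (P (smult q2 u - g)) | q1 q2. q1 + q2 = q}"
    unfolding sum_set_neg[of "\<lambda>p1 p2. inf (P (- f - smult p1 u)) (P (- g - smult p2 u))"] neg ..
  finally show ?thesis .
qed

lemma P_dedekind: "dedekind_real (\<lambda>p. P (f - smult p u)) (\<lambda>q. P (smult q u - f))"
  unfolding dedekind_real_def
proof (intro conjI allI impI)
  fix p p' :: rat assume "p' < p"
  then show "P (f - smult p u) \<le> P (f - smult p' u)"
    by (intro P_mono diff_left_mono smu_mono) simp
next
  fix q q' :: rat assume "q < q'"
  then show "P (smult q u - f) \<le> P (smult q' u - f)"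
    by (intro P_mono diff_right_mono smu_mono) simp
next
  fix p q :: rat assume "p < q"
  then show "sup (P (f - smult p u)) (P (smult q u - f)) = top" by (rule P_located)
next
  fix p q :: rat assume pq: "p < q"
  have "inf (P (f - smult q u)) (P (smult p u - f)) \<le> P ((f - smult q u) + (smult p u - f))"
    by (rule P_meet)
  also have "(f - smult q u) + (smult p u - f) = smult (p - q) u" by (simp add: sm_diffL)
  also have "P \<dots> = bot" using pq by (simp add: P_smu)
  finally show "inf (P (f - smult q u)) (P (smult p u - f)) = bot" by (simp add: bot_unique)
qed (fact P_roundL P_roundU)+

theorem INT_to_FUN: "FUN_model smult u (\<lambda>p f. P (f - smult p u)) (\<lambda>f q. P (smult q u - f))"
  unfolding FUN_model_def
proof (intro conjI allI impI)
  have const: "real_eq_const (\<lambda>p. P (smult (c - p) u)) (\<lambda>q. P (smult (q - c) u)) c" for c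
    unfolding real_eq_const_def by (simp add: P_smu)
  show "real_eq_const (\<lambda>p. P (0 - smult p u)) (\<lambda>q. P (smult q u - 0)) 0"
    using const[of 0] by (simp add: sm_negL)
  show "real_eq_const (\<lambda>p. P (u - smult p u)) (\<lambda>q. P (smult q u - u)) 1"
    using const[of 1] by (simp add: sm_diffL sm_one)
  show "P (smult q u - f) = bot" if "0 \<le> f" "q \<le> 0" for f q
    using that smu_nonpos[of q] by (intro P_nonpos) (simp add: order_trans)
  show "real_add_rel (\<lambda>p. P (f + g - smult p u)) (\<lambda>q. P (smult q u - (f + g)))
          (\<lambda>p. P (f - smult p u)) (\<lambda>q. P (smult q u - f))
          (\<lambda>p. P (g - smult p u)) (\<lambda>q. P (smult q u - g))" for f g
    unfolding real_add_rel_def using P_add P_addU by blast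
qed (rule P_dedekind)

end

section \<open>From FUN to INT\<close>

locale FUN_frame_model = riesz_unit smult u
  for smult :: "rat \<Rightarrow> 'r::{ordered_ab_group_add,lattice} \<Rightarrow> 'r" and u +
  fixes lt :: "rat \<Rightarrow> 'r \<Rightarrow> 'l::complete_lattice" and gt :: "'r \<Rightarrow> rat \<Rightarrow> 'l"
  assumes frame: "frame TYPE('l)" and model: "FUN_model smult u lt gt"
begin

lemma F_ded: "dedekind_real (\<lambda>p. lt p f) (gt f)"
  using model unfolding FUN_model_def by blast
lemma F_zero: "real_eq_const (\<lambda>p. lt p 0) (gt 0) 0"
  using model unfolding FUN_model_def by blast
lemma F_add: "real_add_rel (\<lambda>p. lt p (f + g)) (gt (f + g)) (\<lambda>p. lt p f) (gt f) (\<lambda>p. lt p g) (gt g)"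
  using model unfolding FUN_model_def by blast
lemma F_pos: "0 \<le> f \<Longrightarrow> q \<le> 0 \<Longrightarrow> gt f q = bot"
  using model unfolding FUN_model_def by blast
lemma F_u: "real_eq_const (\<lambda>p. lt p u) (gt u) 1"
  using model unfolding FUN_model_def by blast

text \<open>I (- f) = - I f, since  I f + I (- f) = I 0 = 0.\<close>
lemma F_add_neg:
  "real_add_rel (\<lambda>p. lt p 0) (gt 0) (\<lambda>p. lt p f) (gt f) (\<lambda>p. lt p (- f)) (gt (- f))"
  using F_add[of f "- f"] by simp

lemma F_negL: "lt p (- f) = gt f (- p)"
  using add_neg[OF frame F_ded F_ded F_add_neg F_zero, of p] by simp

lemma F_negU: "gt (- f) q = lt (- q) f"
  using add_neg[OF frame F_ded F_ded add_sym[OF F_add_neg] F_zero, of "- q"] by simp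

lemma F_neg_const:
  "real_eq_const (\<lambda>p. lt p x) (gt x) c \<Longrightarrow> real_eq_const (\<lambda>p. lt p (- x)) (gt (- x)) (- c)"
  unfolding real_eq_const_def by (auto simp: F_negL F_negU)

lemma F_nat: "real_eq_const (\<lambda>p. lt p (smult (of_nat n) u)) (gt (smult (of_nat n) u)) (of_nat n)"
proof (induction n)
  case (Suc n)
  show ?case unfolding sm_Suc using add_const[OF F_add Suc F_u] by (simp add: add.commute)
qed (simp add: F_zero)

lemma F_int: "real_eq_const (\<lambda>p. lt p (smult (of_int m) u)) (gt (smult (of_int m) u)) (of_int m)"
proof (cases "m \<ge> 0")
  case True
  then show ?thesis using F_nat[of "nat m"] by simp
next
  case False
  then have m: "(of_int m :: rat) = - of_nat (nat (- m))" by simp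
  show ?thesis unfolding m sm_negL by (rule F_neg_const[OF F_nat])
qed

lemma F_scaleL: "lt p x \<le> lt (of_nat (Suc k) * p) (smult (of_nat (Suc k)) x)"
proof (induction k)
  case (Suc k)
  have "lt p x \<le> inf (lt (of_nat (Suc k) * p) (smult (of_nat (Suc k)) x)) (lt p x)" using Suc by simp
  also have "\<dots> \<le> lt (of_nat (Suc k) * p + p) (smult (of_nat (Suc k)) x + x)"
    by (rule add_lowerL[OF F_add])
  also have "of_nat (Suc k) * p + p = of_nat (Suc (Suc k)) * p" by (simp add: algebra_simps)
  finally show ?case by (simp only: sm_Suc)
qed (simp add: sm_one)

lemma F_scaleU: "gt x q \<le> gt (smult (of_nat (Suc k)) x) (of_nat (Suc k) * q)"
proof (induction k)
  case (Suc k)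
  have "gt x q \<le> inf (gt (smult (of_nat (Suc k)) x) (of_nat (Suc k) * q)) (gt x q)" using Suc by simp
  also have "\<dots> \<le> gt (smult (of_nat (Suc k)) x + x) (of_nat (Suc k) * q + q)"
    by (rule add_lowerU[OF F_add])
  also have "of_nat (Suc k) * q + q = of_nat (Suc (Suc k)) * q" by (simp add: algebra_simps)
  finally show ?case by (simp only: sm_Suc)
qed (simp add: sm_one)

text \<open>I (c u) = c for every rational c = m / n: scaling by n reduces to the integer m.\<close>
lemma F_rat: "real_eq_const (\<lambda>p. lt p (smult c u)) (gt (smult c u)) c"
proof -
  obtain m n where q: "quotient_of c = (m, n)" by (cases "quotient_of c") auto
  have n: "n > 0" using quotient_of_denom_pos[OF q] .
  have c: "c = of_int m / of_int n" using quotient_of_div[OF q] .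
  define k where "k = nat n - 1"
  have k: "(of_nat (Suc k) :: rat) = of_int n" using n by (simp add: k_def)
  have scale: "smult (of_nat (Suc k)) (smult c u) = smult (of_int m) u"
    unfolding sm_assoc k using n by (simp add: c)
  have below: "of_nat (Suc k) * r < of_int m \<longleftrightarrow> r < c" for r
    unfolding k using n by (simp add: c pos_less_divide_eq mult.commute)
  have above: "of_int m < of_nat (Suc k) * r \<longleftrightarrow> c < r" for r
    unfolding k using n by (simp add: c pos_divide_less_eq mult.commute)
  show ?thesis
  proof (rule const_from_bounds[OF F_ded])
    fix p assume "\<not> p < c"
    then have "lt (of_nat (Suc k) * p) (smult (of_int m) u) = bot"
      using F_int[of m] below[of p] unfolding real_eq_const_def by simp
    then show "lt p (smult c u) = bot" using F_scaleL[of p "smult c u" k] scale by (simp add: bot_unique)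
  next
    fix q assume "\<not> c < q"
    then have "gt (smult (of_int m) u) (of_nat (Suc k) * q) = bot"
      using F_int[of m] above[of q] unfolding real_eq_const_def by simp
    then show "gt (smult c u) q = bot" using F_scaleU[of "smult c u" q k] scale by (simp add: bot_unique)
  qed
qed

lemma F_shiftL: "lt p f = lt 0 (f - smult p u)"
proof -
  have "lt 0 (f + smult (- p) u) = lt (0 - (- p)) f"
    by (rule shift_const[OF F_ded F_add F_rat])
  then show ?thesis by (simp add: sm_negL)
qed

lemma F_shiftU: "gt f q = lt 0 (smult q u - f)"
proof -
  have "lt 0 (smult q u + (- f)) = lt (0 - q) (- f)"
    by (rule shift_const[OF F_ded add_sym[OF F_add] F_rat])
  then show ?thesis by (simp add: F_negL)
qed

lemma lt0_disjoint: "inf (lt 0 f) (lt 0 (- f)) = bot"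
proof -
  have "inf (lt 0 f) (lt 0 (- f)) = inf (gt f 0) (Sup {lt p' f | p'. p' > 0})"
    using dr_roundL[OF F_ded[of f], of 0] by (simp add: F_negL inf_commute)
  also have "\<dots> = Sup ((\<lambda>a. inf (gt f 0) a) ` {lt p' f | p'. p' > 0})"
    by (rule frame_inf_Sup[OF frame])
  also have "\<dots> = bot"
    using dr_disjoint[OF F_ded[of f], of 0] by (auto simp: inf_commute)
  finally show ?thesis .
qed

lemma lt0_subadditive: "lt 0 (f + g) \<le> sup (lt 0 f) (lt 0 g)"
proof -
  have "lt 0 (f + g) = Sup {inf (lt p1 f) (lt p2 g) | p1 p2. p1 + p2 = 0}"
    using F_add[of f g] unfolding real_add_rel_def by blast
  also have "\<dots> \<le> sup (lt 0 f) (lt 0 g)"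
  proof (rule Sup_least)
    fix x assume "x \<in> {inf (lt p1 f) (lt p2 g) | p1 p2. p1 + p2 = 0}"
    then obtain p1 p2 where x: "x = inf (lt p1 f) (lt p2 g)" and pp: "p1 + p2 = 0" by blast
    show "x \<le> sup (lt 0 f) (lt 0 g)"
    proof (cases "p1 \<ge> 0")
      case True
      then have "lt p1 f \<le> lt 0 f" by (intro dr_monoL[OF F_ded])
      then show ?thesis using x by (simp add: le_infI1 le_supI1)
    next
      case False
      then have "lt p2 g \<le> lt 0 g" using pp by (intro dr_monoL[OF F_ded]) simp
      then show ?thesis using x by (simp add: le_infI2 le_supI2)
    qed
  qed
  finally show ?thesis .
qed

lemma lt0_nonpos: "f \<le> 0 \<Longrightarrow> lt 0 f = bot"
  using F_pos[of "- f" 0] F_negU[of f 0] by simp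

lemma lt0_round: "lt 0 f = Sup {lt 0 (f - smult s u) | s. s > 0}"
proof -
  have "lt 0 f = Sup {lt p' f | p'. p' > 0}" by (rule dr_roundL[OF F_ded])
  also have "\<dots> = Sup {lt 0 (f - smult s u) | s. s > 0}" by (simp only: F_shiftL[of _ f])
  finally show ?thesis .
qed

theorem FUN_to_INT: "INT_model smult u (\<lambda>f. lt 0 f)"
  unfolding INT_model_def
proof (intro conjI allI impI)
  show "lt 0 u = top" using F_u unfolding real_eq_const_def by simp
qed (fact lt0_disjoint lt0_subadditive lt0_nonpos lt0_round)+

end

section \<open>Points of INT are integrals\<close>

lemma Sup_bool_iff: "(Sup S :: bool) \<longleftrightarrow> (\<exists>x\<in>S. x)"
  by (metis (full_types) Sup_bool_def)

lemma real_eq_by_rat: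
  fixes x y :: real
  assumes "\<And>p::rat. of_rat p < x \<longleftrightarrow> of_rat p < y"
  shows "x = y"
proof (rule ccontr)
  assume "x \<noteq> y"
  then consider "x < y" | "y < x" by linarith
  then show False
  proof cases
    case 1
    then obtain q where "x < of_rat q" "of_rat q < y" using of_rat_dense by blast
    then show False using assms[of q] by simp
  next
    case 2
    then obtain q where "y < of_rat q" "of_rat q < x" using of_rat_dense by blast
    then show False using assms[of q] by simp
  qed
qed

lemma lower_cut_Sup:
  assumes mono: "\<And>p p'. p' < p \<Longrightarrow> L p \<Longrightarrow> L p'"
    and round: "\<And>p. L p \<Longrightarrow> \<exists>p'>p. L p'"
    and inhabited: "L a" and bounded: "\<not> L b"
  shows "L p \<longleftrightarrow> of_rat p < Sup (of_rat ` {p. L p} :: real set)"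
proof -
  have "x < b" if "L x" for x
    using mono[of b x] that bounded by (cases "b < x") (auto simp: not_less_iff_gr_or_eq)
  then have bdd: "bdd_above (of_rat ` {p. L p} :: real set)"
    by (intro bdd_aboveI[of _ "of_rat b"]) (auto simp: of_rat_less_eq less_imp_le)
  have nonempty: "(of_rat ` {p. L p} :: real set) \<noteq> {}" using inhabited by auto
  show ?thesis
  proof
    assume "L p"
    then obtain p' where "p' > p" "L p'" using round by blast
    then have "(of_rat p :: real) < of_rat p'" "(of_rat p' :: real) \<le> Sup (of_rat ` {p. L p})"
      using bdd by (auto simp: of_rat_less intro!: cSup_upper)
    then show "of_rat p < Sup (of_rat ` {p. L p} :: real set)" by linarith
  next
    assume "of_rat p < Sup (of_rat ` {p. L p} :: real set)"
    then obtain p' where "L p'" "(of_rat p :: real) < of_rat p'"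
      using less_cSup_iff[OF nonempty bdd] by auto
    then show "L p" using mono[of p p'] by (auto simp: of_rat_less)
  qed
qed

context riesz_unit
begin

lemma integral_shift:
  assumes "integral_on smult u I"
  shows "I (f - smult p u) = I f - of_rat p"
proof -
  have add: "I (f + g) = I f + I g" for f g using assms unfolding integral_on_def by blast
  have "I (smult p u) = of_rat p" using assms unfolding integral_on_def by simp
  moreover have "I f = I (f - smult p u) + I (smult p u)" using add[of "f - smult p u" "smult p u"] by simp
  ultimately show ?thesis by simp
qed

lemma integral_INT:
  assumes I: "integral_on smult u I"
  shows "INT_model smult u (\<lambda>f. 0 < I f)"
proof -
  have add: "I (f + g) = I f + I g" for f g using I unfolding integral_on_def by blast
  have pos: "0 \<le> f \<Longrightarrow> 0 \<le> I f" for f using I unfolding integral_on_def by blast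
  have Iu: "I u = 1" using I unfolding integral_on_def by blast
  have Ineg: "I (- f) = - I f" for f using add[of f "- f"] add[of 0 0] by simp
  have round: "0 < I f \<longleftrightarrow> (\<exists>s>0. 0 < I (f - smult s u))" for f
  proof
    assume "0 < I f"
    then obtain s where "(0::real) < of_rat s" "of_rat s < I f" using of_rat_dense[of 0 "I f"] by blast
    then show "\<exists>s>0. 0 < I (f - smult s u)" by (auto simp: integral_shift[OF I])
  next
    assume "\<exists>s>0. 0 < I (f - smult s u)"
    then obtain s where "s > 0" "of_rat s < I f" by (auto simp: integral_shift[OF I])
    moreover from \<open>s > 0\<close> have "(0::real) < of_rat s" by simp
    ultimately show "0 < I f" by linarith
  qed
  show ?thesis unfolding INT_model_def
  proof (intro conjI allI impI)
    show "(0 < I (f + g)) \<le> sup (0 < I f) (0 < I g)" for f g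
      using add[of f g] by auto
    show "(0 < I f) = bot" if "f \<le> 0" for f
      using pos[of "- f"] that Ineg[of f] by simp
    show "(0 < I f) = Sup {0 < I (f - smult s u) | s. s > 0}" for f
      using round[of f] unfolding Sup_bool_iff by blast
  qed (simp_all add: Iu Ineg)
qed

lemma INT_point_model: "INT_model smult u P \<Longrightarrow> INT_frame_model smult u (P :: 'r \<Rightarrow> bool)"
  using riesz unit frame_bool
  by (simp add: INT_frame_model_def riesz_unit_def rat_module_def riesz_unit_axioms_def
      INT_frame_model_axioms_def)

text \<open>Conversely a point P of INT is a family of cuts  P (f - p u), and
  cut_integral P f  is the real number they define.\<close>
definition cut_integral :: "('r \<Rightarrow> bool) \<Rightarrow> 'r \<Rightarrow> real" where
  "cut_integral P f = Sup (of_rat ` {p. P (f - smult p u)})"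

lemma cut_integral_less_iff:
  assumes "INT_model smult u P"
  shows "P (f - smult p u) \<longleftrightarrow> of_rat p < cut_integral P f"
proof -
  interpret INT_frame_model smult u P by (rule INT_point_model[OF assms])
  obtain N where N: "N > 0" "smult (- N) u \<le> f" "f \<le> smult N u" using bounded by blast
  have mono: "P (f - smult p' u)" if "p' < p" "P (f - smult p u)" for p p'
    using dr_monoL[OF P_dedekind, of p' p f] that by simp
  have round: "\<exists>p'>p. P (f - smult p' u)" if "P (f - smult p u)" for p
    using that P_roundL[of f p] by (auto simp: Sup_bool_iff)
  have "P (smult 1 u) \<le> P (f - smult (- N - 1) u)"
    using N(2) by (intro P_mono) (simp add: sm_diffL algebra_simps)
  then have inhabited: "P (f - smult (- N - 1) u)" by (simp add: P_smu)
  have bounded: "\<not> P (f - smult N u)" using N(3) P_nonpos[of "f - smult N u"] by simp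
  show ?thesis unfolding cut_integral_def
    by (rule lower_cut_Sup[of "\<lambda>p. P (f - smult p u)", OF mono round inhabited bounded])
qed

lemma cut_integral_add:
  assumes P: "INT_model smult u P"
  shows "cut_integral P (f + g) = cut_integral P f + cut_integral P g"
proof (rule real_eq_by_rat)
  interpret INT_frame_model smult u P by (rule INT_point_model[OF P])
  fix p :: rat
  let ?I = "cut_integral P"
  have "of_rat p < ?I (f + g) \<longleftrightarrow> P (f + g - smult p u)"
    by (simp add: cut_integral_less_iff[OF P])
  also have "\<dots> \<longleftrightarrow> (\<exists>p1 p2. p1 + p2 = p \<and> P (f - smult p1 u) \<and> P (g - smult p2 u))"
    unfolding P_add Sup_bool_iff by auto
  also have "\<dots> \<longleftrightarrow> (\<exists>p1 p2. p1 + p2 = p \<and> of_rat p1 < ?I f \<and> of_rat p2 < ?I g)"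
    by (simp add: cut_integral_less_iff[OF P])
  also have "\<dots> \<longleftrightarrow> of_rat p < ?I f + ?I g"
  proof
    assume "\<exists>p1 p2. p1 + p2 = p \<and> of_rat p1 < ?I f \<and> of_rat p2 < ?I g"
    then show "of_rat p < ?I f + ?I g" by (auto simp: of_rat_add intro: add_strict_mono)
  next
    assume "of_rat p < ?I f + ?I g"
    then have "of_rat p - ?I g < ?I f" by simp
    then obtain p1 where p1: "of_rat p - ?I g < of_rat p1" "of_rat p1 < ?I f"
      using of_rat_dense by blast
    then have "of_rat (p - p1) < ?I g" by (simp add: of_rat_diff)
    with p1(2) show "\<exists>p1 p2. p1 + p2 = p \<and> of_rat p1 < ?I f \<and> of_rat p2 < ?I g" by force
  qed
  finally show "of_rat p < ?I (f + g) \<longleftrightarrow> of_rat p < ?I f + ?I g" .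
qed

lemma cut_integral_integral:
  assumes P: "INT_model smult u P"
  shows "integral_on smult u (cut_integral P)" and "(\<lambda>f. 0 < cut_integral P f) = P"
proof -
  interpret INT_frame_model smult u P by (rule INT_point_model[OF P])
  let ?I = "cut_integral P"
  have pos: "0 \<le> ?I f" if "0 \<le> f" for f
  proof (rule ccontr)
    assume "\<not> 0 \<le> ?I f"
    then have "?I f < 0" by simp
    then obtain q where q: "?I f < of_rat q" "of_rat q < (0::real)" using of_rat_dense by blast
    have "P (smult (- q) u) \<le> P (f - smult q u)" using that by (intro P_mono) (simp add: sm_negL)
    then have "P (f - smult q u)" using q(2) by (simp add: P_smu)
    then show False using cut_integral_less_iff[OF P, of f q] q(1) by simp
  qed
  have Iu: "?I u = 1"
  proof (rule real_eq_by_rat)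
    fix p :: rat
    have "u - smult p u = smult (1 - p) u" by (simp add: sm_diffL sm_one)
    then have "of_rat p < ?I u \<longleftrightarrow> p < 1"
      using cut_integral_less_iff[OF P, of u p] by (cases "p < 1") (simp_all add: P_smu)
    then show "of_rat p < ?I u \<longleftrightarrow> of_rat p < (1::real)" by simp
  qed
  show "integral_on smult u ?I" unfolding integral_on_def
  proof (intro conjI allI impI)
    show "?I (smult r f) = of_rat r * ?I f" for r f
      by (rule additive_rat_homogeneous[of ?I, OF cut_integral_add[OF P]])
  qed (simp_all add: cut_integral_add[OF P] pos Iu)
  show "(\<lambda>f. 0 < ?I f) = P"
  proof
    fix f show "(0 < ?I f) = P f" using cut_integral_less_iff[OF P, of f 0] by simp
  qed
qed

theorem integrals_INT_points:
  "bij_betw (\<lambda>I f. 0 < I f) {I. integral_on smult u I} {P :: 'r \<Rightarrow> bool. INT_model smult u P}"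
proof (rule bij_betw_imageI)
  show "inj_on (\<lambda>I f. 0 < I f) {I. integral_on smult u I}"
  proof (rule inj_onI, rule ext, rule real_eq_by_rat)
    fix I J f p
    assume "I \<in> {I. integral_on smult u I}" "J \<in> {I. integral_on smult u I}"
      and "(\<lambda>f. 0 < I f) = (\<lambda>f. 0 < J f)"
    then show "of_rat p < I f \<longleftrightarrow> of_rat p < J f"
      using fun_cong[of "\<lambda>f. 0 < I f" "\<lambda>f. 0 < J f" "f - smult p u"] by (simp add: integral_shift)
  qed
  show "(\<lambda>I f. 0 < I f) ` {I. integral_on smult u I} = {P. INT_model smult u P}"
  proof
    show "(\<lambda>I f. 0 < I f) ` {I. integral_on smult u I} \<subseteq> {P. INT_model smult u P}"
      using integral_INT by auto
    show "{P. INT_model smult u P} \<subseteq> (\<lambda>I f. 0 < I f) ` {I. integral_on smult u I}"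
    proof
      fix P :: "'r \<Rightarrow> bool" assume "P \<in> {P. INT_model smult u P}"
      then have P: "INT_model smult u P" by simp
      show "P \<in> (\<lambda>I f. 0 < I f) ` {I. integral_on smult u I}"
        by (rule image_eqI[of P _ "cut_integral P"]) (simp_all add: cut_integral_integral[OF P])
    qed
  qed
qed

end

theorem lemma3p4:
  fixes smult :: "rat \<Rightarrow> 'r::{ordered_ab_group_add,lattice} \<Rightarrow> 'r"
    and u :: 'r
  assumes "riesz_space_Q smult"
    and "strong_unit smult u"
    and "frame TYPE('l::complete_lattice)"
  shows "(\<forall>(lt :: rat \<Rightarrow> 'r \<Rightarrow> 'l) gt. FUN_model smult u lt gt \<longrightarrow>
            INT_model smult u (\<lambda>f. lt 0 f) \<and>
            (\<forall>p f. lt p f = lt 0 (f - smult p u)) \<and>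
            (\<forall>f q. gt f q = lt 0 (smult q u - f)))
       \<and> (\<forall>P :: 'r \<Rightarrow> 'l. INT_model smult u P \<longrightarrow>
            FUN_model smult u (\<lambda>p f. P (f - smult p u)) (\<lambda>f q. P (smult q u - f)) \<and>
            (\<forall>f. P (f - smult 0 u) = P f))
       \<and> bij_betw (\<lambda>I f. 0 < I f) {I. integral_on smult u I} {P :: 'r \<Rightarrow> bool. INT_model smult u P}"
proof -
  have R: "riesz_unit smult u"
    using assms(1,2) by (simp add: riesz_unit_def rat_module_def riesz_unit_axioms_def)
  show ?thesis
  proof (intro conjI allI impI)
    fix lt :: "rat \<Rightarrow> 'r \<Rightarrow> 'l" and gt
    assume "FUN_model smult u lt gt"
    then interpret FUN_frame_model smult u lt gt
      using R assms(3) by (simp add: FUN_frame_model_def FUN_frame_model_axioms_def)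
    show "INT_model smult u (\<lambda>f. lt 0 f)" by (rule FUN_to_INT)
    show "lt p f = lt 0 (f - smult p u)" for p f by (rule F_shiftL)
    show "gt f q = lt 0 (smult q u - f)" for f q by (rule F_shiftU)
  next
    fix P :: "'r \<Rightarrow> 'l"
    assume "INT_model smult u P"
    then interpret INT_frame_model smult u P
      using R assms(3) by (simp add: INT_frame_model_def INT_frame_model_axioms_def)
    show "FUN_model smult u (\<lambda>p f. P (f - smult p u)) (\<lambda>f q. P (smult q u - f))"
      by (rule INT_to_FUN)
    show "P (f - smult 0 u) = P f" for f by simp
  next
    show "bij_betw (\<lambda>I f. 0 < I f) {I. integral_on smult u I} {P :: 'r \<Rightarrow> bool. INT_model smult u P}"
      by (rule riesz_unit.integrals_INT_points[OF R])
  qed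
qed

end
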